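(* Let $a,b,c\in\mathbb{Z}^+$ with $v_2(b)\equiv v_2(c)\pmod 2$. Assume that $a'\equiv b'\equiv c'\pmod 4$ fails. Then either none of the forms $ax^2+by^2+2cT_z$ and $ax^2+cy^2+2bT_z$ is asymptotically universal, or none of the forms $ax^2+2cy^2+bT_z$ and $ax^2+2by^2+cT_z$ is asymptotically universal.
   Context: $\mathbb{Z}^{+}=\{1,2,3,\ldots\}$. For $x\in\mathbb{Z}$, $T_x=x(x+1)/2$. A form $f(x,y,z)$ of the listed types (variables ranging over $\mathbb{Z}$) is asymptotically universal if $\lim_{N\to\infty}\frac1N|\{1\le n\le N: n=f(x,y,z)\text{ for some }x,y,z\in\mathbb{Z}\}|=1$. For a positive integer $n$, $v_2(n)$ is the 2-adic order of $n$ and $n'=n/2^{v_2(n)}$ is the odd part of $n$. *)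

theory Defs
  imports Complex_Main "HOL-Number_Theory.Cong"
begin

text \<open>The division is exact, since the product of consecutive integers is even.\<close>
definition triangular :: "int \<Rightarrow> int" where
  "triangular x = x * (x + 1) div 2"

definition asymptotically_universal :: "(int \<Rightarrow> int \<Rightarrow> int \<Rightarrow> int) \<Rightarrow> bool" where
  "asymptotically_universal f \<longleftrightarrow>
     (\<lambda>N::nat. real (card {n::nat. 1 \<le> n \<and> n \<le> N \<and> (\<exists>x y z. int n = f x y z)}) / real N)
       \<longlonglongrightarrow> 1"

abbreviation v2 :: "int \<Rightarrow> nat" where
  "v2 n \<equiv> multiplicity 2 n"

definition odd_part :: "int \<Rightarrow> int" where
  "odd_part n = n div 2 ^ v2 n"

end

theory Submission
  imports Defs "HOL-Number_Theory.Number_Theory" "HOL-Computational_Algebra.Squarefree"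
begin

text \<open>
  Completing the square turns \<open>n = a x\<^sup>2 + b y\<^sup>2 + 2 c T\<^sub>z\<close> into a representation of \<open>4 n + c\<close>
  by the diagonal form \<open>\<langle>a, b, c\<rangle>\<close>, and \<open>n = a x\<^sup>2 + 2 c y\<^sup>2 + b T\<^sub>z\<close> into a representation of
  \<open>8 n + b\<close> by \<open>\<langle>2 a, c, b\<rangle>\<close>. One of \<open>a\<close>, \<open>2 a\<close> has 2-adic order of the same parity as
  \<open>b\<close> and \<open>c\<close>; the corresponding form is then, up to 2-adic scaling, a form with odd coefficients
  that are not all congruent modulo 4, hence isotropic at 2. Being positive definite, it must be
  anisotropic at an odd number of finite primes, so at some odd prime \<open>p\<close>; in elementary terms,
  for squarefree pairwise coprime coefficients the product of the Jacobi symbols \<open>(-bc|a)\<close>,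
  \<open>(-ca|b)\<close>, \<open>(-ab|c)\<close> is -1 by quadratic reciprocity. A ternary form anisotropic at \<open>p\<close> does
  not represent the class of \<open>-abc\<close> modulo p-adic squares, so a whole residue class modulo a power
  of \<open>p\<close> is missed.
\<close>

subsection \<open>Jacobi symbols\<close>

definition Jacobi :: "int \<Rightarrow> nat \<Rightarrow> int" where
  "Jacobi a n = (\<Prod>p\<in>#prime_factorization n. Legendre a (int p))"

lemma Jacobi_one_right [simp]: "Jacobi a (Suc 0) = 1"
  by (simp add: Jacobi_def)

lemma Jacobi_prime: "prime p \<Longrightarrow> Jacobi a p = Legendre a (int p)"
  by (simp add: Jacobi_def prime_factorization_prime)

lemma Jacobi_mult_right:
  assumes "m > 0" "n > 0"
  shows "Jacobi a (m * n) = Jacobi a m * Jacobi a n"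
  using assms by (simp add: Jacobi_def prime_factorization_mult)

text \<open>Two signs differ by at most 2, hence by less than \<open>p\<close>. This turns the
  congruences of Euler's criterion into equalities.\<close>

lemma cong_imp_eq_of_signs:
  fixes x y p :: int
  assumes "[x = y] (mod p)" "p > 2" "x \<in> {-1, 0, 1}" "y \<in> {-1, 0, 1}"
  shows "x = y"
proof -
  have "p dvd x - y" using assms(1) by (simp add: cong_iff_dvd_diff)
  moreover have "\<bar>x - y\<bar> < p" using assms(2-4) by auto
  ultimately show ?thesis using zdvd_not_zless[of "\<bar>x - y\<bar>" p] by fastforce
qed

lemma Legendre_in_signs: "Legendre a p \<in> {-1, 0, 1}"
  by (simp add: Legendre_def)

lemma Legendre_mult:
  fixes p :: nat
  assumes "prime p" "p > 2"
  shows "Legendre (a * b) p = Legendre a p * Legendre b p"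
proof (rule cong_imp_eq_of_signs)
  have "[Legendre (a * b) p = (a * b) ^ ((p - 1) div 2)] (mod p)"
    by (rule euler_criterion[OF assms])
  moreover have "[Legendre a p * Legendre b p = a ^ ((p - 1) div 2) * b ^ ((p - 1) div 2)] (mod p)"
    by (intro cong_mult euler_criterion assms)
  ultimately show "[Legendre (a * b) p = Legendre a p * Legendre b p] (mod p)"
    by (metis cong_sym cong_trans power_mult_distrib)
qed (use assms Legendre_in_signs[of _ p] in \<open>auto simp: Legendre_def\<close>)

lemma odd_prime_factor_gt_2:
  fixes n :: nat
  assumes "odd n" "p \<in> prime_factors n"
  shows "prime p" "p > 2" "odd p"
proof -
  show "prime p" using assms by blast
  show "odd p" using assms by (meson dvd_trans in_prime_factors_iff)
  then show "p > 2" using prime_ge_2_nat[OF \<open>prime p\<close>] by (cases "p = 2") auto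
qed

lemma Jacobi_mult_left:
  assumes "odd n"
  shows "Jacobi (a * b) n = Jacobi a n * Jacobi b n"
proof -
  have "Jacobi (a * b) n = (\<Prod>p\<in>#prime_factorization n. Legendre a (int p) * Legendre b (int p))"
    unfolding Jacobi_def
    by (rule arg_cong[of _ _ prod_mset], rule image_mset_cong)
       (use odd_prime_factor_gt_2[OF assms] Legendre_mult in auto)
  then show ?thesis by (simp add: Jacobi_def prod_mset.distrib)
qed

lemma Jacobi_one_left:
  assumes "odd n"
  shows "Jacobi 1 n = 1"
proof -
  have "Legendre 1 (int p) = 1" if "p \<in> prime_factors n" for p
  proof -
    have "QuadRes (int p) 1" by (auto simp: QuadRes_def intro!: exI[of _ 1])
    then show ?thesis using odd_prime_factor_gt_2[OF assms that]
      by (auto simp: Legendre_def cong_def)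
  qed
  then have "Jacobi 1 n = (\<Prod>p\<in>#prime_factorization n. 1)"
    unfolding Jacobi_def by (intro arg_cong[of _ _ prod_mset] image_mset_cong) auto
  then show ?thesis by simp
qed

lemma odd_induct [consumes 1, case_names one factor]:
  fixes n :: nat
  assumes "odd n"
    and "P 1"
    and "\<And>p x. prime p \<Longrightarrow> p > 2 \<Longrightarrow> odd p \<Longrightarrow> odd x \<Longrightarrow> P x \<Longrightarrow> P (p * x)"
  shows "P n"
proof -
  have "odd n \<longrightarrow> P n"
  proof (induction n rule: prime_divisors_induct)
    case (factor p x)
    show ?case
    proof
      assume "odd (p * x)"
      moreover from this have "p \<noteq> 2" by auto
      ultimately show "P (p * x)"
        using factor assms(3)[of p x] prime_ge_2_nat[of p] by auto
    qed
  qed (use assms(2) in auto)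
  with assms(1) show ?thesis by blast
qed

lemma odd_mod_4_cases:
  fixes n :: nat
  assumes "odd n"
  obtains "n mod 4 = 1" | "n mod 4 = 3"
proof -
  have "n mod 4 = 1 \<or> n mod 4 = 3" using assms by presburger
  with that show ?thesis by blast
qed

text \<open>Meaningful for odd \<open>n\<close> only; the value at even \<open>n\<close> is junk.\<close>
definition chi4 :: "nat \<Rightarrow> int" where
  "chi4 n = (if n mod 4 = 1 then 1 else -1)"

text \<open>For odd arguments this is the sign (-1)^((m-1)/2 * (n-1)/2) of quadratic reciprocity.
  Stated through residues modulo 4, its multiplicativity becomes a finite check.\<close>

definition recip_sign :: "nat \<Rightarrow> nat \<Rightarrow> int" where
  "recip_sign m n = (if m mod 4 = 3 \<and> n mod 4 = 3 then -1 else 1)"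

lemma mod_4_mult:
  fixes m n :: nat
  shows "(m * n) mod 4 = ((m mod 4) * (n mod 4)) mod 4"
  by (simp add: mod_mult_eq)

lemma chi4_mult: "odd m \<Longrightarrow> odd n \<Longrightarrow> chi4 (m * n) = chi4 m * chi4 n"
  by (elim odd_mod_4_cases) (simp_all add: chi4_def mod_4_mult)

lemma recip_sign_mult:
  assumes "odd l" "odd m" "odd n"
  shows "recip_sign (l * m) n = recip_sign l n * recip_sign m n"
    and "recip_sign n (l * m) = recip_sign n l * recip_sign n m"
  using assms by (elim odd_mod_4_cases; simp add: recip_sign_def mod_4_mult)+

lemma half_parity:
  fixes n :: nat
  assumes "odd n"
  shows "even ((n - 1) div 2) \<longleftrightarrow> n mod 4 = 1"
  using assms by presburger

lemma Legendre_minus_one: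
  assumes "prime p" "p > 2" "odd p"
  shows "Legendre (-1) (int p) = chi4 p"
proof (rule cong_imp_eq_of_signs)
  have "[Legendre (-1) (int p) = (-1) ^ ((p - 1) div 2)] (mod p)"
    by (rule euler_criterion[OF assms(1,2)])
  moreover have "(-1::int) ^ ((p - 1) div 2) = chi4 p"
    using half_parity[OF assms(3)] by (simp add: chi4_def)
  ultimately show "[Legendre (-1) (int p) = chi4 p] (mod int p)" by simp
qed (use assms Legendre_in_signs in \<open>auto simp: chi4_def\<close>)

lemma Jacobi_minus_one: "odd n \<Longrightarrow> Jacobi (-1) n = chi4 n"
proof (induction n rule: odd_induct)
  case (factor p x)
  then show ?case
    using odd_pos[of x] Jacobi_mult_right[of p x "-1"]
    by (simp add: Jacobi_prime Legendre_minus_one chi4_mult)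
qed (simp add: chi4_def)

lemma Legendre_reciprocity:
  assumes "prime p" "p > 2" "odd p" "prime q" "q > 2" "odd q" "p \<noteq> q"
  shows "Legendre (int p) (int q) * Legendre (int q) (int p) = recip_sign p q"
proof -
  have "p mod 4 = 3 \<longleftrightarrow> p mod 4 \<noteq> 1" "q mod 4 = 3 \<longleftrightarrow> q mod 4 \<noteq> 1"
    using assms(3,6) by presburger+
  then show ?thesis
    using Quadratic_Reciprocity[OF assms(1,2,4,5,7)] half_parity[OF assms(3)] half_parity[OF assms(6)]
    by (auto simp: recip_sign_def)
qed

text \<open>Both sides are multiplicative in \<open>m\<close>, so reciprocity for two primes
  suffices; coprimality keeps each prime factor of \<open>m\<close> distinct from
  \<open>q\<close>.\<close>

lemma Jacobi_reciprocity_prime: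
  assumes "odd m" "prime q" "q > 2" "odd q" "coprime m q"
  shows "Jacobi (int m) q * Jacobi (int q) m = recip_sign m q"
  using assms(1,5)
proof (induction m rule: odd_induct)
  case one
  then show ?case using Jacobi_one_left[OF assms(4)] by (simp add: recip_sign_def)
next
  case (factor p x)
  have cop: "coprime x q" "p \<noteq> q" using factor.hyps(1) factor.prems by auto
  have "Jacobi (int (p * x)) q * Jacobi (int q) (p * x) =
      (Legendre (int p) (int q) * Legendre (int q) (int p)) * (Jacobi (int x) q * Jacobi (int q) x)"
    using odd_pos[of x] factor.hyps assms
    by (simp add: Jacobi_mult_left Jacobi_mult_right Jacobi_prime Legendre_mult mult_ac)
  also have "\<dots> = recip_sign p q * recip_sign x q"
    using factor cop assms by (simp add: Legendre_reciprocity)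
  finally show ?case using factor.hyps assms by (simp add: recip_sign_mult)
qed

lemma Jacobi_reciprocity:
  assumes "odd m" "odd n" "coprime m n"
  shows "Jacobi (int m) n * Jacobi (int n) m = recip_sign m n"
  using assms(2,3)
proof (induction n rule: odd_induct)
  case one
  then show ?case using Jacobi_one_left[OF assms(1)] by (simp add: recip_sign_def)
next
  case (factor p x)
  have cop: "coprime m p" "coprime m x" using factor.prems by auto
  have "Jacobi (int m) (p * x) * Jacobi (int (p * x)) m =
      (Jacobi (int m) p * Jacobi (int p) m) * (Jacobi (int m) x * Jacobi (int x) m)"
    using odd_pos[of x] factor.hyps assms
    by (simp add: Jacobi_mult_left Jacobi_mult_right mult_ac)
  also have "\<dots> = recip_sign m p * recip_sign m x"
    using factor cop assms by (simp add: Jacobi_reciprocity_prime)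
  finally show ?case using factor.hyps assms by (simp add: recip_sign_mult)
qed

lemma exists_prime_Legendre_ne_1:
  assumes "Jacobi a n \<noteq> 1"
  obtains p where "p \<in> prime_factors n" "Legendre a (int p) \<noteq> 1"
proof (rule ccontr)
  assume "\<not> thesis"
  then have "Jacobi a n = (\<Prod>p\<in>#prime_factorization n. 1)"
    unfolding Jacobi_def using that
    by (intro arg_cong[of _ _ prod_mset] image_mset_cong) blast
  with assms show False by simp
qed

text \<open>After splitting off the factors -1, the six remaining symbols pair up under reciprocity.
  What is left is a sign depending only on the residues modulo 4, equal to 1 exactly when all three
  agree.\<close>

lemma prod_Jacobi_neg:
  assumes "odd a" "odd b" "odd c" "coprime a b" "coprime b c" "coprime c a"
    and "\<not> (a mod 4 = b mod 4 \<and> b mod 4 = c mod 4)"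
  shows "Jacobi (- int (b * c)) a * Jacobi (- int (c * a)) b * Jacobi (- int (a * b)) c = -1"
proof -
  have neg: "Jacobi (- int (m * n)) k = chi4 k * Jacobi (int m) k * Jacobi (int n) k"
    if "odd k" for m n k
    using Jacobi_mult_left[OF that, of "-1" "int (m * n)"] Jacobi_mult_left[OF that, of "int m" "int n"]
    by (simp add: Jacobi_minus_one[OF that])
  have "Jacobi (- int (b * c)) a * Jacobi (- int (c * a)) b * Jacobi (- int (a * b)) c =
     chi4 a * chi4 b * chi4 c * (Jacobi (int a) b * Jacobi (int b) a)
     * (Jacobi (int b) c * Jacobi (int c) b) * (Jacobi (int c) a * Jacobi (int a) c)"
    unfolding neg[OF assms(1)] neg[OF assms(2)] neg[OF assms(3)] by (simp add: mult_ac)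
  also have "\<dots> = chi4 a * chi4 b * chi4 c * recip_sign a b * recip_sign b c * recip_sign c a"
    using assms by (simp add: Jacobi_reciprocity)
  also have "\<dots> = -1"
    using assms(1-3,7) by (elim odd_mod_4_cases) (simp_all add: chi4_def recip_sign_def)
  finally show ?thesis .
qed

subsection \<open>Residue classes missed by diagonal ternary forms\<close>

text \<open>Representation of \<open>m\<close> over the rationals, with \<open>d\<close> a common denominator. Integral representations
  would not do: the reduction of the coefficients needs the missed set to be closed under square factors.\<close>
definition rat_rep :: "int \<Rightarrow> int \<Rightarrow> int \<Rightarrow> int \<Rightarrow> bool" where
  "rat_rep a b c m \<longleftrightarrow> (\<exists>d x y z. d \<noteq> 0 \<and> d\<^sup>2 * m = a * x\<^sup>2 + b * y\<^sup>2 + c * z\<^sup>2)"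

text \<open>The prime is required to be odd so that powers of 2 are invertible modulo
  \<open>p ^ k\<close>; completing the square multiplies the represented number by 4 or 8.\<close>

definition misses_class :: "int \<Rightarrow> int \<Rightarrow> int \<Rightarrow> bool" where
  "misses_class a b c \<longleftrightarrow>
     (\<exists>p k m0. prime p \<and> odd p \<and> (\<forall>m. [m = m0] (mod p ^ k) \<longrightarrow> \<not> rat_rep a b c m))"

lemma rat_rep_swap: "rat_rep a b c = rat_rep b a c" "rat_rep a b c = rat_rep a c b"
proof -
  have "rat_rep b a c m" if "rat_rep a b c m" for a b c m
    using that unfolding rat_rep_def by (metis add.commute)
  then show "rat_rep a b c = rat_rep b a c" by (intro ext iffI)
  have "rat_rep a c b m" if rep: "rat_rep a b c m" for a b c m
  proof -
    from rep obtain d x y z where "d \<noteq> 0" "d\<^sup>2 * m = a * x\<^sup>2 + b * y\<^sup>2 + c * z\<^sup>2"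
      unfolding rat_rep_def by blast
    then have "d \<noteq> 0 \<and> d\<^sup>2 * m = a * x\<^sup>2 + c * z\<^sup>2 + b * y\<^sup>2" by simp
    then show ?thesis unfolding rat_rep_def by blast
  qed
  then show "rat_rep a b c = rat_rep a c b" by (intro ext iffI)
qed

lemma misses_class_swap:
  "misses_class a b c \<longleftrightarrow> misses_class b a c" "misses_class a b c \<longleftrightarrow> misses_class a c b"
  unfolding misses_class_def by (metis rat_rep_swap)+

lemma misses_class_rotate: "misses_class c a b \<Longrightarrow> misses_class a b c"
  using misses_class_swap by blast

section \<open>Anisotropy at an odd prime\<close>

text \<open>If \<open>d\<close> were invertible modulo \<open>p\<close>, division by its square
  would exhibit \<open>N\<close> as a square.\<close>

lemma nonresidue_dvd:
  fixes p :: int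
  assumes "prime p" "\<not> QuadRes p N" "p dvd x\<^sup>2 - N * d\<^sup>2"
  shows "p dvd d"
proof (rule ccontr)
  assume "\<not> p dvd d"
  then have "coprime d p" using prime_imp_coprime[OF assms(1)] by (simp add: coprime_commute)
  then obtain e where e: "[d * e = 1] (mod p)" using cong_solve_coprime_int by blast
  have "[x\<^sup>2 = N * d\<^sup>2] (mod p)" using assms(3) by (simp add: cong_iff_dvd_diff)
  then have "[x\<^sup>2 * e\<^sup>2 = N * d\<^sup>2 * e\<^sup>2] (mod p)" by (rule cong_scalar_right)
  then have "[(x * e)\<^sup>2 = N * (d * e)\<^sup>2] (mod p)"
    by (simp only: power_mult_distrib mult.assoc)
  moreover have "[N * (d * e)\<^sup>2 = N * 1\<^sup>2] (mod p)"
    by (intro cong_mult cong_pow e cong_refl)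
  ultimately have "[(x * e)\<^sup>2 = N * 1\<^sup>2] (mod p)" by (rule cong_trans)
  with assms(2) show False by (auto simp: QuadRes_def)
qed

text \<open>Here \<open>\<langle>p a, b, c\<rangle>\<close> is anisotropic at \<open>p\<close>, and \<open>p m\<close> lies in its exceptional class, that of
  \<open>- p a b c\<close>. Since \<open>-bc\<close> is a nonresidue, \<open>p\<close> divides \<open>y\<close> and \<open>z\<close>, then \<open>d\<close> and \<open>x\<close>.\<close>
lemma local_descent:
  fixes p :: int
  assumes p: "prime p" and nr: "\<not> QuadRes p (- (b * c))"
    and nd: "\<not> p dvd a" "\<not> p dvd b" "\<not> p dvd c"
    and m: "p dvd m + a * b * c"
    and eq: "d\<^sup>2 * (p * m) = p * a * x\<^sup>2 + b * y\<^sup>2 + c * z\<^sup>2"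
  shows "d = 0"
  using eq
proof (induction "nat \<bar>d\<bar>" arbitrary: d x y z rule: less_induct)
  case less
  note eq = less.prems
  have "b * y\<^sup>2 + c * z\<^sup>2 = p * (d\<^sup>2 * m - a * x\<^sup>2)" using eq by (simp add: algebra_simps)
  then have dv: "p dvd b * y\<^sup>2 + c * z\<^sup>2" by simp
  \<comment> \<open>The factor \<open>b\<close> turns the binary part into a square minus
    \<open>- (b * c)\<close> times a square.\<close>
  then have "p dvd b * (b * y\<^sup>2 + c * z\<^sup>2)" by simp
  moreover have "b * (b * y\<^sup>2 + c * z\<^sup>2) = (b * y)\<^sup>2 - (- (b * c)) * z\<^sup>2"
    by (simp add: power2_eq_square algebra_simps)
  ultimately have z: "p dvd z" using nonresidue_dvd[OF p nr] by metis
  then have "p dvd c * z\<^sup>2" by (simp add: power2_eq_square)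
  with dv have "p dvd b * y\<^sup>2" by (simp add: dvd_add_left_iff)
  with p nd have y: "p dvd y" by (meson prime_dvd_mult_iff prime_dvd_power)
  from y z obtain y' z' where yz: "y = p * y'" "z = p * z'" by (auto simp: dvd_def)
  have "p * (d\<^sup>2 * m) = p * (a * x\<^sup>2 + p * (b * y'\<^sup>2 + c * z'\<^sup>2))"
    using eq by (simp add: yz power2_eq_square algebra_simps)
  then have eq2: "d\<^sup>2 * m = a * x\<^sup>2 + p * (b * y'\<^sup>2 + c * z'\<^sup>2)"
    using p by (simp add: prime_gt_0_int)
  \<comment> \<open>Modulo \<open>p\<close> the number \<open>m\<close> may be replaced by
    \<open>- (a * b * c)\<close>, which produces the same nonresidue form again, now in
    \<open>x\<close> and \<open>d\<close>.\<close>
  have "a * (x\<^sup>2 - (- (b * c)) * d\<^sup>2) = d\<^sup>2 * (m + a * b * c) - p * (b * y'\<^sup>2 + c * z'\<^sup>2)"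
    using eq2 by (simp add: algebra_simps)
  then have "p dvd a * (x\<^sup>2 - (- (b * c)) * d\<^sup>2)" using m by simp
  then have dx: "p dvd x\<^sup>2 - (- (b * c)) * d\<^sup>2" using p nd prime_dvd_mult_iff by blast
  then have d: "p dvd d" using nonresidue_dvd[OF p nr] by blast
  then have "p dvd (- (b * c)) * d\<^sup>2" by (simp add: power2_eq_square)
  with dx have "p dvd x\<^sup>2" by (metis diff_add_cancel dvd_add)
  with p have "p dvd x" by (meson prime_dvd_power)
  with d obtain d' x' where dx: "d = p * d'" "x = p * x'" by (auto simp: dvd_def)
  \<comment> \<open>All four variables are divisible by \<open>p\<close>, so the equation reproduces
    itself with a smaller denominator: infinite descent on the absolute value of
    \<open>d\<close>.\<close>
  have "p\<^sup>2 * (d'\<^sup>2 * (p * m)) = p\<^sup>2 * (p * a * x'\<^sup>2 + b * y'\<^sup>2 + c * z'\<^sup>2)"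
    using eq by (simp add: yz dx power2_eq_square algebra_simps)
  then have eq': "d'\<^sup>2 * (p * m) = p * a * x'\<^sup>2 + b * y'\<^sup>2 + c * z'\<^sup>2"
    using p by simp
  show "d = 0"
  proof (rule ccontr)
    assume "d \<noteq> 0"
    then have "\<bar>d'\<bar> < \<bar>d\<bar>" using dx prime_gt_1_int[OF p] by (simp add: abs_mult)
    then have "d' = 0" using less.hyps[OF _ eq'] by simp
    with dx \<open>d \<noteq> 0\<close> show False by simp
  qed
qed

text \<open>The modulus is the square of \<open>p\<close> because the missed numbers are
  \<open>p\<close> times a number that is fixed modulo \<open>p\<close>.\<close>

lemma misses_class_local:
  fixes p :: int
  assumes "prime p" "odd p" "\<not> QuadRes p (- (b * c))"
    and "\<not> p dvd a" "\<not> p dvd b" "\<not> p dvd c"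
  shows "misses_class (p * a) b c"
proof -
  have "\<not> rat_rep (p * a) b c m" if "[m = - (p * a * b * c)] (mod p ^ 2)" for m
  proof
    assume rep: "rat_rep (p * a) b c m"
    from that obtain t where "m + p * a * b * c = p\<^sup>2 * t"
      by (auto simp: cong_iff_dvd_diff dvd_def)
    then have "m = p * (p * t - a * b * c)" by (simp add: power2_eq_square algebra_simps)
    moreover have "p dvd (p * t - a * b * c) + a * b * c" by simp
    ultimately show False
      using rep local_descent[OF assms(1,3-6)] unfolding rat_rep_def by metis
  qed
  with assms(1,2) show ?thesis unfolding misses_class_def by blast
qed

section \<open>Changing the coefficients\<close>

text \<open>If \<open>q\<close> differs from \<open>p\<close>, it is invertible modulo
  \<open>p ^ k\<close> and the class is divided by it. If \<open>q = p\<close>, the class of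
  \<open>p * m0\<close> modulo \<open>p ^ Suc k\<close> works: multiplication by \<open>q\<close>
  then yields a factor \<open>p\<^sup>2\<close>, absorbed into the denominator.\<close>

lemma misses_class_transfer:
  fixes q :: int
  assumes "misses_class a b c" "prime q"
    and rep: "\<And>m. rat_rep a' b' c' m \<Longrightarrow> rat_rep a b c (q * m)"
  shows "misses_class a' b' c'"
proof -
  obtain p k m0 where p: "prime p" "odd p"
    and miss: "\<And>m. [m = m0] (mod p ^ k) \<Longrightarrow> \<not> rat_rep a b c m"
    using assms(1) unfolding misses_class_def by blast
  show ?thesis
  proof (cases "q = p")
    case True
    have "\<not> rat_rep a' b' c' m" if "[m = p * m0] (mod p ^ Suc k)" for m
    proof
      assume "rat_rep a' b' c' m"
      from that obtain t where "m - p * m0 = p ^ Suc k * t"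
        by (auto simp: cong_iff_dvd_diff dvd_def)
      then have m: "m = p * (m0 + p ^ k * t)" by (simp add: algebra_simps)
      have "rat_rep a b c (p\<^sup>2 * (m0 + p ^ k * t))"
        using rep[OF \<open>rat_rep a' b' c' m\<close>] by (simp add: True m power2_eq_square mult_ac)
      then obtain d x y z where "d \<noteq> 0"
        "d\<^sup>2 * (p\<^sup>2 * (m0 + p ^ k * t)) = a * x\<^sup>2 + b * y\<^sup>2 + c * z\<^sup>2"
        unfolding rat_rep_def by blast
      then have "d * p \<noteq> 0 \<and> (d * p)\<^sup>2 * (m0 + p ^ k * t) = a * x\<^sup>2 + b * y\<^sup>2 + c * z\<^sup>2"
        using p by (auto simp: power_mult_distrib mult.assoc)
      then have "rat_rep a b c (m0 + p ^ k * t)" unfolding rat_rep_def by blast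
      moreover have "[m0 + p ^ k * t = m0] (mod p ^ k)" by (simp add: cong_iff_dvd_diff)
      ultimately show False using miss by blast
    qed
    with p show ?thesis unfolding misses_class_def by blast
  next
    case False
    then have "coprime q (p ^ k)" using p assms(2) by (simp add: primes_coprime)
    then obtain e where e: "[q * e = 1] (mod p ^ k)" using cong_solve_coprime_int by blast
    have "\<not> rat_rep a' b' c' m" if m: "[m = e * m0] (mod p ^ k)" for m
    proof -
      have "[q * m = q * (e * m0)] (mod p ^ k)" using m by (rule cong_scalar_left)
      then have "[q * m = q * e * m0] (mod p ^ k)" by (simp only: mult.assoc)
      moreover have "[q * e * m0 = 1 * m0] (mod p ^ k)" using e by (rule cong_scalar_right)
      ultimately have "[q * m = m0] (mod p ^ k)" using cong_trans by fastforce
      with miss rep show ?thesis by blast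
    qed
    with p show ?thesis unfolding misses_class_def by blast
  qed
qed

lemma misses_class_mult_square:
  assumes "misses_class a b c"
  shows "misses_class (q\<^sup>2 * a) b c"
proof -
  have "rat_rep a b c m" if "rat_rep (q\<^sup>2 * a) b c m" for m
  proof -
    from that obtain d x y z where "d \<noteq> 0" "d\<^sup>2 * m = q\<^sup>2 * a * x\<^sup>2 + b * y\<^sup>2 + c * z\<^sup>2"
      unfolding rat_rep_def by blast
    then have "d \<noteq> 0 \<and> d\<^sup>2 * m = a * (q * x)\<^sup>2 + b * y\<^sup>2 + c * z\<^sup>2"
      by (simp add: power_mult_distrib)
    then show ?thesis unfolding rat_rep_def by blast
  qed
  with assms show ?thesis unfolding misses_class_def by blast
qed

lemma misses_class_scale:
  fixes q :: int
  assumes "misses_class a b c" "prime q"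
  shows "misses_class (q * a) (q * b) (q * c)"
proof (rule misses_class_transfer[OF assms])
  fix m assume "rat_rep (q * a) (q * b) (q * c) m"
  then obtain d x y z where "d \<noteq> 0" "d\<^sup>2 * m = q * a * x\<^sup>2 + q * b * y\<^sup>2 + q * c * z\<^sup>2"
    unfolding rat_rep_def by blast
  moreover from this have "q * (d\<^sup>2 * m) = a * (q * x)\<^sup>2 + b * (q * y)\<^sup>2 + c * (q * z)\<^sup>2"
    by (simp add: power2_eq_square algebra_simps)
  ultimately have "d \<noteq> 0 \<and> d\<^sup>2 * (q * m) = a * (q * x)\<^sup>2 + b * (q * y)\<^sup>2 + c * (q * z)\<^sup>2"
    by (simp add: mult.left_commute)
  then show "rat_rep a b c (q * m)" unfolding rat_rep_def by blast
qed

text \<open>Multiplying the new form by \<open>q\<close> makes its first two coefficients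
  \<open>q\<^sup>2 * a\<close> and \<open>q\<^sup>2 * b\<close>, and the squares go into the
  variables. This serves to remove a prime common to two coefficients.\<close>

lemma misses_class_move_factor:
  fixes q :: int
  assumes "misses_class a b (q * c)" "prime q"
  shows "misses_class (q * a) (q * b) c"
proof (rule misses_class_transfer[OF assms])
  fix m assume "rat_rep (q * a) (q * b) c m"
  then obtain d x y z where "d \<noteq> 0" "d\<^sup>2 * m = q * a * x\<^sup>2 + q * b * y\<^sup>2 + c * z\<^sup>2"
    unfolding rat_rep_def by blast
  moreover from this have "q * (d\<^sup>2 * m) = a * (q * x)\<^sup>2 + b * (q * y)\<^sup>2 + q * c * z\<^sup>2"
    by (simp add: power2_eq_square algebra_simps)
  ultimately have "d \<noteq> 0 \<and> d\<^sup>2 * (q * m) = a * (q * x)\<^sup>2 + b * (q * y)\<^sup>2 + q * c * z\<^sup>2"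
    by (simp add: mult.left_commute)
  then show "rat_rep a b (q * c) (q * m)" unfolding rat_rep_def by blast
qed

text \<open>Some prime factor \<open>p\<close> of \<open>a\<close> has Legendre symbol different
  from 1. Coprimality excludes the value 0, so \<open>- (b * c)\<close> is a nonresidue;
  squarefreeness makes \<open>p\<close> divide \<open>a\<close> exactly once.\<close>

lemma misses_class_of_Jacobi:
  assumes "odd a" "squarefree a" "coprime a b" "coprime c a"
    and "Jacobi (- int (b * c)) a \<noteq> 1"
  shows "misses_class (int a) (int b) (int c)"
proof -
  obtain p where p: "p \<in> prime_factors a" and L: "Legendre (- int (b * c)) (int p) \<noteq> 1"
    using exists_prime_Legendre_ne_1[OF assms(5)] by blast
  note p' = odd_prime_factor_gt_2[OF assms(1) p]
  have "p dvd a" using p by blast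
  then obtain a0 where a0: "a = p * a0" by blast
  have "\<not> p dvd a0"
  proof
    assume "p dvd a0"
    then have "p\<^sup>2 dvd a" by (auto simp: a0 power2_eq_square)
    then have "is_unit p" using assms(2) by (simp add: squarefree_def)
    with p'(1) show False by auto
  qed
  moreover have "\<not> p dvd b" "\<not> p dvd c"
    using assms(3,4) \<open>p dvd a\<close> p'(1) by (metis coprime_common_divisor not_prime_unit)+
  moreover from this have "\<not> int p dvd - int (b * c)"
    using p'(1) by (simp only: dvd_minus_iff int_dvd_int_iff) (simp add: prime_dvd_mult_iff)
  then have "\<not> QuadRes (int p) (- (int b * int c))"
    using L by (auto simp: Legendre_def cong_0_iff split: if_splits)
  ultimately have "misses_class (int p * int a0) (int b) (int c)"
    using p' by (intro misses_class_local) auto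
  then show ?thesis by (simp add: a0)
qed

section \<open>Reduction to squarefree, pairwise coprime odd coefficients\<close>

abbreviation admissible :: "nat \<Rightarrow> nat \<Rightarrow> nat \<Rightarrow> bool" where
  "admissible a b c \<equiv> odd a \<and> odd b \<and> odd c \<and> \<not> (a mod 4 = b mod 4 \<and> b mod 4 = c mod 4)"

text \<open>Since \<open>q\<close> is odd, its square is 1 modulo 4, so the new triple is
  \<open>q\<close> times the old one modulo 4.\<close>

lemma admissible_move_factor:
  assumes "admissible (q * a) (q * b) c"
  shows "admissible a b (q * c)"
proof -
  have "odd q" "odd a" "odd b" "odd c" using assms by auto
  then show ?thesis using assms by (elim odd_mod_4_cases) (simp_all add: mod_4_mult)
qed

text \<open>An odd square is 1 modulo 4, so removing it preserves admissibility. The bound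
  \<open>N\<close> is kept apart from the product so that the induction hypothesis also serves
  permuted coefficients.\<close>

lemma reduce_square:
  assumes IH: "\<forall>a' b' c'. a' * b' * c' < N \<longrightarrow> admissible a' b' c' \<longrightarrow>
      misses_class (int a') (int b') (int c')"
    and N: "a * b * c = N"
    and adm: "admissible a b c" and q: "q\<^sup>2 dvd a" "q \<noteq> 1"
  shows "misses_class (int a) (int b) (int c)"
proof -
  obtain a0 where a0: "a = q\<^sup>2 * a0" using q by blast
  have "odd q" "odd a0" "odd b" "odd c" using adm a0 by auto
  have "q > 1" using \<open>odd q\<close> q(2) by (cases q) auto
  have "q\<^sup>2 mod 4 = 1"
    using \<open>odd q\<close> by (elim odd_mod_4_cases) (simp_all add: mod_4_mult power2_eq_square)
  then have "a mod 4 = a0 mod 4" unfolding a0 by (metis mod_mult_left_eq mult_1)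
  then have "admissible a0 b c" using adm \<open>odd a0\<close> by simp
  moreover have "a0 * b * c < a * b * c"
    using \<open>q > 1\<close> \<open>odd a0\<close> \<open>odd b\<close> \<open>odd c\<close> one_less_power[of q 2] by (auto simp: a0 odd_pos)
  ultimately have "misses_class (int a0) (int b) (int c)" using IH N by blast
  from misses_class_mult_square[OF this, of "int q"] show ?thesis by (simp add: a0)
qed

text \<open>Moving the common prime \<open>q\<close> to the third coefficient divides the product of
  the coefficients by \<open>q\<close>.\<close>

lemma reduce_common_prime:
  assumes IH: "\<forall>a' b' c'. a' * b' * c' < N \<longrightarrow> admissible a' b' c' \<longrightarrow>
      misses_class (int a') (int b') (int c')"
    and N: "a * b * c = N"
    and adm: "admissible a b c" and ncop: "\<not> coprime a b"
  shows "misses_class (int a) (int b) (int c)"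
proof -
  have "gcd a b \<noteq> 1" using ncop coprime_iff_gcd_eq_1 by blast
  then obtain q where "prime q" "q dvd gcd a b" using prime_factor_nat by blast
  then have q: "prime q" "q dvd a" "q dvd b" by auto
  obtain a0 b0 where ab: "a = q * a0" "b = q * b0" using q by blast
  have "odd a0" "odd b0" "odd c" "odd q" using adm ab by auto
  have "admissible a0 b0 (q * c)" by (rule admissible_move_factor[OF adm[unfolded ab]])
  moreover have "a0 * b0 * (q * c) < a * b * c"
    using prime_gt_1_nat[OF q(1)] \<open>odd a0\<close> \<open>odd b0\<close> \<open>odd c\<close> by (auto simp: ab odd_pos)
  ultimately have "misses_class (int a0) (int b0) (int (q * c))" using IH N by blast
  then show ?thesis
    using misses_class_move_factor[of "int a0" "int b0" "int q" "int c"] q(1) by (simp add: ab)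
qed

text \<open>Induction on the product of the coefficients: a square factor or a common prime lowers
  it, and otherwise the product formula for Jacobi symbols applies.\<close>

lemma misses_class_odd:
  assumes "admissible a b c"
  shows "misses_class (int a) (int b) (int c)"
  using assms
proof (induction "a * b * c" arbitrary: a b c rule: less_induct)
  case less
  note adm = less.prems
  have IH: "\<forall>a' b' c'. a' * b' * c' < a * b * c \<longrightarrow> admissible a' b' c' \<longrightarrow>
      misses_class (int a') (int b') (int c')"
    using less.hyps by blast
  consider "\<not> squarefree a" | "\<not> squarefree b" | "\<not> squarefree c"
    | "\<not> coprime a b" | "\<not> coprime b c" | "\<not> coprime c a"
    | "squarefree a" "squarefree b" "squarefree c" "coprime a b" "coprime b c" "coprime c a"
    by blast
  then show ?case
  proof cases
    case 1
    then obtain q where "q\<^sup>2 dvd a" "q \<noteq> 1" unfolding squarefree_def by auto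
    with adm show ?thesis
      by (intro reduce_square[OF IH]) (auto simp: mult_ac)
  next
    case 2
    then obtain q where "q\<^sup>2 dvd b" "q \<noteq> 1" unfolding squarefree_def by auto
    with adm have "misses_class (int b) (int a) (int c)"
      by (intro reduce_square[OF IH]) (auto simp: mult_ac)
    then show ?thesis using misses_class_swap(1) by blast
  next
    case 3
    then obtain q where "q\<^sup>2 dvd c" "q \<noteq> 1" unfolding squarefree_def by auto
    with adm have "misses_class (int c) (int a) (int b)"
      by (intro reduce_square[OF IH]) (auto simp: mult_ac)
    then show ?thesis by (rule misses_class_rotate)
  next
    case 4
    with adm show ?thesis
      by (intro reduce_common_prime[OF IH]) (auto simp: mult_ac)
  next
    case 5
    with adm have "misses_class (int b) (int c) (int a)"
      by (intro reduce_common_prime[OF IH]) (auto simp: mult_ac)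
    then show ?thesis by (rule misses_class_rotate[OF misses_class_rotate])
  next
    case 6
    with adm have "misses_class (int c) (int a) (int b)"
      by (intro reduce_common_prime[OF IH]) (auto simp: mult_ac)
    then show ?thesis by (rule misses_class_rotate)
  next
    case 7
    have "Jacobi (- int (b * c)) a * Jacobi (- int (c * a)) b * Jacobi (- int (a * b)) c = -1"
      using adm 7 by (intro prod_Jacobi_neg) auto
    then consider "Jacobi (- int (b * c)) a \<noteq> 1" | "Jacobi (- int (c * a)) b \<noteq> 1"
      | "Jacobi (- int (a * b)) c \<noteq> 1"
      by force
    then show ?thesis
    proof cases
      case 1
      with adm 7 show ?thesis by (intro misses_class_of_Jacobi) blast+
    next
      case 2
      with adm 7 have "misses_class (int b) (int c) (int a)"
        by (intro misses_class_of_Jacobi) blast+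
      then show ?thesis by (rule misses_class_rotate[OF misses_class_rotate])
    next
      case 3
      with adm 7 have "misses_class (int c) (int a) (int b)"
        by (intro misses_class_of_Jacobi) blast+
      then show ?thesis by (rule misses_class_rotate)
    qed
  qed
qed

section \<open>Powers of 2 in the coefficients\<close>

lemma misses_class_mult_power:
  assumes "misses_class a b c"
  shows "misses_class (4 ^ i * a) (4 ^ j * b) (4 ^ k * c)"
proof -
  have step: "misses_class (4 ^ n * a) b c" if "misses_class a b c" for n a b c
  proof -
    have "((2::int) ^ n)\<^sup>2 = 4 ^ n" by (induction n) (auto simp: power2_eq_square)
    with misses_class_mult_square[OF that, of "2 ^ n"] show ?thesis by simp
  qed
  \<comment> \<open>Each rotation brings the next coefficient to the front, where
    \<open>step\<close> acts.\<close>
  have "misses_class (4 ^ j * b) c (4 ^ i * a)"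
    by (rule step[OF misses_class_rotate[OF step[OF assms]]])
  then have "misses_class (4 ^ k * c) (4 ^ i * a) (4 ^ j * b)"
    by (rule step[OF misses_class_rotate])
  then show ?thesis by (rule misses_class_rotate)
qed

lemma odd_part_decomp:
  fixes n :: int
  assumes "n > 0"
  shows "n = 2 ^ v2 n * odd_part n" "odd (odd_part n)" "odd_part n > 0"
proof -
  show eq: "n = 2 ^ v2 n * odd_part n" by (simp add: odd_part_def multiplicity_dvd)
  show "odd (odd_part n)" unfolding odd_part_def
    using assms by (intro multiplicity_decompose) auto
  show "odd_part n > 0" using eq assms by (metis zero_less_mult_pos zero_less_numeral zero_less_power)
qed

text \<open>By the common parity \<open>r\<close> of the 2-adic orders, each coefficient is a power
  of 4 times \<open>2 ^ r\<close> times its odd part. Powers of 4 are squares, and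
  \<open>2 ^ r\<close> is a common scaling.\<close>

lemma misses_class_pos:
  fixes a b c :: int
  assumes pos: "a > 0" "b > 0" "c > 0"
    and par: "[v2 a = v2 b] (mod 2)" "[v2 b = v2 c] (mod 2)"
    and ne: "\<not> ([odd_part a = odd_part b] (mod 4) \<and> [odd_part b = odd_part c] (mod 4))"
  shows "misses_class a b c"
proof -
  note dec = odd_part_decomp[OF pos(1)] odd_part_decomp[OF pos(2)] odd_part_decomp[OF pos(3)]
  obtain a' b' c' where n: "odd_part a = int a'" "odd_part b = int b'" "odd_part c = int c'"
    using dec by (metis zero_less_imp_eq_int)
  have "odd a'" "odd b'" "odd c'" using dec n by simp_all
  moreover have "\<not> (a' mod 4 = b' mod 4 \<and> b' mod 4 = c' mod 4)"
    using ne cong_int_iff[of a' b' 4] cong_int_iff[of b' c' 4] unfolding n by (simp add: cong_def)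
  ultimately have base: "misses_class (odd_part a) (odd_part b) (odd_part c)"
    unfolding n using misses_class_odd by blast
  define r where "r = v2 a mod 2"
  have split: "n = 4 ^ (v2 n div 2) * (2 ^ r * odd_part n)" if "n > 0" "v2 n mod 2 = r" for n :: int
  proof -
    have "(2::int) ^ (2 * (v2 n div 2) + r) = 4 ^ (v2 n div 2) * 2 ^ r"
      by (simp add: power_add power_mult)
    moreover have "2 * (v2 n div 2) + r = v2 n" using that(2) by presburger
    ultimately have "(2::int) ^ v2 n = 4 ^ (v2 n div 2) * 2 ^ r" by metis
    then show ?thesis using odd_part_decomp(1)[OF that(1)] by simp
  qed
  have "r = 0 \<or> r = 1" unfolding r_def by auto
  then have "misses_class (2 ^ r * odd_part a) (2 ^ r * odd_part b) (2 ^ r * odd_part c)"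
    using base misses_class_scale[OF base, of 2] by auto
  note scaled = misses_class_mult_power[OF this, of "v2 a div 2" "v2 b div 2" "v2 c div 2"]
  have v: "v2 a mod 2 = r" "v2 b mod 2 = r" "v2 c mod 2 = r"
    using par by (simp_all add: r_def cong_def)
  show ?thesis
    using scaled split[OF pos(1) v(1)] split[OF pos(2) v(2)] split[OF pos(3) v(3)] by metis
qed

subsection \<open>From missed classes to density\<close>

text \<open>Missing a residue class modulo \<open>M\<close> would bound the upper density by
  \<open>1 - 1 / M\<close>.\<close>

lemma asymptotically_universal_meets_class:
  assumes "asymptotically_universal f" "M > 0"
  shows "\<exists>n x y z. [n = n0] (mod M) \<and> n = f x y z"
proof (rule ccontr)
  assume miss: "\<not> ?thesis"
  define S where "S N = {n::nat. 1 \<le> n \<and> n \<le> N \<and> (\<exists>x y z. int n = f x y z)}" for N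
  define K where "K = nat M"
  have K: "K > 0" "int K = M" using assms(2) by (auto simp: K_def)
  define r where "r = nat (n0 mod M)"
  have r: "int r = n0 mod M" "r < K" using assms(2) K by (auto simp: r_def K_def nat_less_iff)
  have bound: "card (S (K * t)) + t \<le> K * t + K" for t
  proof -
    \<comment> \<open>Starting at \<open>Suc i\<close> keeps the values positive even for
      \<open>r = 0\<close>. They may pass \<open>K * t\<close> by at most \<open>r < K\<close>,
      whence the extra \<open>K\<close> in the bound.\<close>
    let ?g = "\<lambda>i. r + K * Suc i"
    have inj: "inj_on ?g {..<t}" using K by (auto simp: inj_on_def)
    have "?g ` {..<t} \<inter> S (K * t) = {}"
    proof (intro equalityI subsetI, elim IntE imageE)
      fix n i assume n: "n \<in> S (K * t)" "n = ?g i"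
      then have "int n = n0 mod M + M * int (Suc i)" using r(1) K(2) by (simp add: distrib_left)
      then have "[int n = n0] (mod M)" by (simp add: cong_def del: of_nat_Suc)
      with n(1) miss show "n \<in> {}" unfolding S_def by blast
    qed auto
    then have "card (?g ` {..<t} \<union> S (K * t)) = t + card (S (K * t))"
      using inj by (subst card_Un_disjoint) (auto simp: card_image S_def)
    moreover have "?g ` {..<t} \<union> S (K * t) \<subseteq> {1..K * t + K}"
    proof
      fix n assume "n \<in> ?g ` {..<t} \<union> S (K * t)"
      then show "n \<in> {1..K * t + K}"
      proof
        assume "n \<in> ?g ` {..<t}"
        then obtain i where i: "i < t" "n = ?g i" by auto
        have "K * Suc i \<le> K * t" using i by (intro mult_le_mono) auto
        then show ?thesis using i r K by auto
      qed (auto simp: S_def)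
    qed
    ultimately show ?thesis using card_mono[of "{1..K * t + K}" "?g ` {..<t} \<union> S (K * t)"] by simp
  qed
  have "(\<lambda>N. real (card (S N)) / real N) \<longlonglongrightarrow> 1"
    using assms(1) unfolding asymptotically_universal_def S_def .
  \<comment> \<open>Along positive multiples of \<open>K\<close> the bound applies directly and the
    denominators are nonzero.\<close>
  moreover have "strict_mono (\<lambda>t. K * Suc t)" using K by (simp add: strict_mono_def)
  ultimately have "((\<lambda>N. real (card (S N)) / real N) \<circ> (\<lambda>t. K * Suc t)) \<longlonglongrightarrow> 1"
    by (rule LIMSEQ_subseq_LIMSEQ)
  then have "(\<lambda>t. real (card (S (K * Suc t))) / real (K * Suc t)) \<longlonglongrightarrow> 1"
    by (simp only: comp_def)
  moreover have "(\<lambda>t. 1 - 1 / real K + inverse (real (Suc t))) \<longlonglongrightarrow> 1 - 1 / real K + 0"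
    by (intro tendsto_intros LIMSEQ_inverse_real_of_nat)
  moreover have "real (card (S (K * Suc t))) / real (K * Suc t) \<le> 1 - 1 / real K + inverse (real (Suc t))" for t
  proof -
    have "real (card (S (K * Suc t))) + real (Suc t) \<le> real (K * Suc t) + real K"
      using bound[of "Suc t"] by (metis of_nat_add of_nat_le_iff)
    then have "real (card (S (K * Suc t))) / real (K * Suc t) \<le>
        (real (K * Suc t) + real K - real (Suc t)) / real (K * Suc t)"
      by (intro divide_right_mono) auto
    also have "\<dots> = 1 - 1 / real K + inverse (real (Suc t))"
    proof -
      have "(k * u + k - u) / (k * u) = 1 - 1 / k + inverse u" if "k > 0" "u > 0" for k u :: real
        using that by (simp add: field_simps)
      from this[of "real K" "real (Suc t)"] show ?thesis
        using K by (simp only: of_nat_mult of_nat_0_less_iff zero_less_Suc)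
    qed
    finally show ?thesis .
  qed
  ultimately have "1 \<le> 1 - 1 / real K + 0"
    by (intro LIMSEQ_le) auto
  with K show False by simp
qed

text \<open>As \<open>p\<close> is odd, \<open>2 ^ e\<close> has an inverse \<open>s\<close> modulo
  \<open>p ^ k\<close>; values of \<open>f\<close> in the class of \<open>s * (m0 - t)\<close> would
  put \<open>2 ^ e * n + t\<close> into the missed class.\<close>

lemma not_asymptotically_universal:
  assumes "misses_class a b c" "\<And>x y z. rat_rep a b c (2 ^ e * f x y z + t)"
  shows "\<not> asymptotically_universal f"
proof
  assume au: "asymptotically_universal f"
  obtain p k m0 where p: "prime p" "odd p"
    and miss: "\<And>m. [m = m0] (mod p ^ k) \<Longrightarrow> \<not> rat_rep a b c m"
    using assms(1) unfolding misses_class_def by blast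
  have "coprime ((2::int) ^ e) (p ^ k)" using p(2) by simp
  then obtain s where s: "[2 ^ e * s = 1] (mod p ^ k)" using cong_solve_coprime_int by blast
  obtain n x y z where n: "[n = s * (m0 - t)] (mod p ^ k)" "n = f x y z"
    using asymptotically_universal_meets_class[OF au, of "p ^ k"] prime_gt_0_int[OF p(1)]
    by (metis zero_less_power)
  have "[2 ^ e * n = 2 ^ e * (s * (m0 - t))] (mod p ^ k)" using n(1) by (rule cong_scalar_left)
  then have "[2 ^ e * n = 2 ^ e * s * (m0 - t)] (mod p ^ k)" by (simp only: mult.assoc)
  moreover have "[2 ^ e * s * (m0 - t) = 1 * (m0 - t)] (mod p ^ k)" using s by (rule cong_scalar_right)
  ultimately have "[2 ^ e * n = 1 * (m0 - t)] (mod p ^ k)" by (rule cong_trans)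
  then have "[2 ^ e * n + t = m0] (mod p ^ k)" by (simp add: cong_iff_dvd_diff algebra_simps)
  with miss assms(2) n(2) show False by blast
qed

lemma rat_rep_integral: "m = a * x\<^sup>2 + b * y\<^sup>2 + c * z\<^sup>2 \<Longrightarrow> rat_rep a b c m"
  unfolding rat_rep_def
  by (rule exI[of _ 1], rule exI[of _ x], rule exI[of _ y], rule exI[of _ z]) simp

lemma eight_triangular: "8 * triangular z + 1 = (2 * z + 1)\<^sup>2"
proof -
  have "2 * triangular z = z * (z + 1)" unfolding triangular_def by simp
  then show ?thesis by (simp add: power2_eq_square algebra_simps)
qed

lemma not_asymptotically_universal_2T:
  assumes "misses_class a b c"
  shows "\<not> asymptotically_universal (\<lambda>x y z. a * x\<^sup>2 + b * y\<^sup>2 + 2 * c * triangular z)"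
proof (rule not_asymptotically_universal[where e = 2 and t = c, OF assms], rule rat_rep_integral)
  fix x y z :: int
  have "c * (8 * triangular z + 1) = c * (2 * z + 1)\<^sup>2" by (simp only: eight_triangular)
  then show "2\<^sup>2 * (a * x\<^sup>2 + b * y\<^sup>2 + 2 * c * triangular z) + c =
      a * (2 * x)\<^sup>2 + b * (2 * y)\<^sup>2 + c * (2 * z + 1)\<^sup>2"
    by (simp add: algebra_simps)
qed

text \<open>After multiplication by 8 the term in \<open>y\<close> is
  \<open>c * (4 * y)\<^sup>2\<close>, so only the first coefficient gains a factor 2, which flips
  the parity of its 2-adic order.\<close>

lemma not_asymptotically_universal_T:
  assumes "misses_class (2 * a) c b"
  shows "\<not> asymptotically_universal (\<lambda>x y z. a * x\<^sup>2 + 2 * c * y\<^sup>2 + b * triangular z)"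
proof (rule not_asymptotically_universal[where e = 3 and t = b, OF assms], rule rat_rep_integral)
  fix x y z :: int
  have "b * (8 * triangular z + 1) = b * (2 * z + 1)\<^sup>2" by (simp only: eight_triangular)
  then show "2 ^ 3 * (a * x\<^sup>2 + 2 * c * y\<^sup>2 + b * triangular z) + b =
      2 * a * (2 * x)\<^sup>2 + c * (4 * y)\<^sup>2 + b * (2 * z + 1)\<^sup>2"
    by (simp add: algebra_simps)
qed

lemma v2_double: "a > 0 \<Longrightarrow> v2 (2 * a) = Suc (v2 a)"
  by (simp add: multiplicity_times_same)

lemma odd_part_double: "a > 0 \<Longrightarrow> odd_part (2 * a) = odd_part a"
  by (simp add: odd_part_def v2_double)

theorem corollary1p5:
  fixes a b c :: int
  assumes "a > 0" and "b > 0" and "c > 0"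
    and "[v2 b = v2 c] (mod 2)"
    and "\<not> ([odd_part a = odd_part b] (mod 4) \<and> [odd_part b = odd_part c] (mod 4))"
  shows "(\<not> asymptotically_universal (\<lambda>x y z. a * x^2 + b * y^2 + 2 * c * triangular z) \<and>
          \<not> asymptotically_universal (\<lambda>x y z. a * x^2 + c * y^2 + 2 * b * triangular z)) \<or>
         (\<not> asymptotically_universal (\<lambda>x y z. a * x^2 + 2 * c * y^2 + b * triangular z) \<and>
          \<not> asymptotically_universal (\<lambda>x y z. a * x^2 + 2 * b * y^2 + c * triangular z))"
proof (cases "[v2 a = v2 b] (mod 2)")
  case True
  then have miss: "misses_class a b c" using assms by (intro misses_class_pos)
  then have "misses_class a c b" using misses_class_swap(2) by blast
  with miss show ?thesis
    using not_asymptotically_universal_2T by blast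
next
  case False
  \<comment> \<open>Doubling \<open>a\<close> repairs the parity and leaves its odd part, hence the
    condition modulo 4, unchanged.\<close>
  then have "[v2 (2 * a) = v2 b] (mod 2)"
    using assms(1) unfolding v2_double[OF assms(1)] cong_def by presburger
  then have miss: "misses_class (2 * a) b c"
    using assms by (intro misses_class_pos) (simp_all add: odd_part_double)
  then have "misses_class (2 * a) c b" using misses_class_swap(2) by blast
  with miss show ?thesis
    using not_asymptotically_universal_T by blast
qed

end
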